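(* Let $(\alpha,\rho)\in\mathcal{A}$. Let $X_{\alpha,\rho}$ be a real random variable with the free stable distribution $\nu_{\alpha,\rho}$, let $Y_{\alpha,\rho}$ be a real random variable with the classical stable distribution $\mu_{\alpha,\rho}$, and let $Z$ be a Gamma(2) random variable, i.e. a positive random variable with density $p_Z(x)=xe^{-x}$ for $x>0$. If $X_{\alpha,\rho}$ and $Z$ are independent (in the classical sense), then $$Y_{\alpha,\rho}\stackrel{d}{=}X_{\alpha,\rho}\times Z^{1-1/\alpha}.$$
   Context: The set of admissible parameters is $$\mathcal{A}=\{(\alpha,\rho):\alpha\in(0,1),\ \rho\in[0,1]\}\cup\{(\alpha,\rho):\alpha\in(1,2],\ \rho\in[1-\alpha^{-1},\alpha^{-1}]\}.$$ All powers use the principal branch. For $(\alpha,\rho)\in\mathcal{A}$: (1) The classical stable distribution $\mu_{\alpha,\rho}$ is the probability measure on $\mathbb{R}$ with characteristic function $\int_{\mathbb{R}}e^{izx}\mu_{\alpha,\rho}(dx)=\exp\left(-z^{\alpha}e^{\pi i\alpha(1/2-\rho)}\right)$ for $z>0$. (2) The free stable distribution $\nu_{\alpha,\rho}$ is the probability measure on $\mathbb{R}$ (known to exist and be unique) whose Voiculescu transform is $\phi_{\alpha,\rho}(z)=-e^{\pi i\alpha\rho}z^{-\alpha+1}$ for $\operatorname{Im}(z)>0$. This means that its Cauchy transform $G_{\alpha,\rho}(z)=\int_{\mathbb{R}}\frac{\nu_{\alpha,\rho}(dx)}{z-x}$, $\operatorname{Im}(z)>0$ (which takes values in the lower half-plane),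 is the inverse function of $w\mapsto \frac1w+\phi_{\alpha,\rho}(\frac1w)$, i.e. $w=G_{\alpha,\rho}(z)$ satisfies $z=w^{-1}-e^{\pi i\alpha\rho}w^{\alpha-1}$ for all $z$ with $\operatorname{Im}(z)>0$. The symbol $\stackrel{d}{=}$ denotes equality in distribution. *)

theory Defs
  imports "HOL-Probability.Probability"
begin

definition admissible_params :: "(real \<times> real) set" where
  "admissible_params =
     {(\<alpha>, \<rho>). 0 < \<alpha> \<and> \<alpha> < 1 \<and> 0 \<le> \<rho> \<and> \<rho> \<le> 1} \<union>
     {(\<alpha>, \<rho>). 1 < \<alpha> \<and> \<alpha> \<le> 2 \<and> 1 - 1 / \<alpha> \<le> \<rho> \<and> \<rho> \<le> 1 / \<alpha>}"

(* Only z > 0 is prescribed: the values at z < 0 are the complex conjugates. *)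
definition classical_stable :: "real \<Rightarrow> real \<Rightarrow> real measure \<Rightarrow> bool" where
  "classical_stable \<alpha> \<rho> \<mu> \<longleftrightarrow> real_distribution \<mu> \<and>
     (\<forall>z>0. char \<mu> z =
        exp (- (complex_of_real (z powr \<alpha>) * exp (\<i> * complex_of_real (pi * \<alpha> * (1/2 - \<rho>))))))"

definition cauchy_transform :: "real measure \<Rightarrow> complex \<Rightarrow> complex" where
  "cauchy_transform \<nu> z = (\<integral>x. 1 / (z - complex_of_real x) \<partial>\<nu>)"

(* For phi given on the whole upper half-plane. Here w lies in the lower half-plane, so that
   1/w lies in the upper half-plane, where the values of phi are meaningful. *)
definition has_voiculescu_transform :: "real measure \<Rightarrow> (complex \<Rightarrow> complex) \<Rightarrow> bool" where
  "has_voiculescu_transform \<nu> \<phi> \<longleftrightarrow>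
     (\<forall>z. Im z > 0 \<longrightarrow> (let w = cauchy_transform \<nu> z in 1 / w + \<phi> (1 / w) = z))"

definition free_stable_phi :: "real \<Rightarrow> real \<Rightarrow> complex \<Rightarrow> complex" where
  "free_stable_phi \<alpha> \<rho> z =
     - (exp (\<i> * complex_of_real (pi * \<alpha> * \<rho>)) * z powr complex_of_real (1 - \<alpha>))"

definition free_stable :: "real \<Rightarrow> real \<Rightarrow> real measure \<Rightarrow> bool" where
  "free_stable \<alpha> \<rho> \<nu> \<longleftrightarrow>
     real_distribution \<nu> \<and> has_voiculescu_transform \<nu> (free_stable_phi \<alpha> \<rho>)"

end

theory Submission
  imports Defs "HOL-Complex_Analysis.Complex_Analysis" "HOL-Real_Asymp.Real_Asymp"
begin

text \<open>
A probability measure on the line is determined by the values of its Cauchy transform on the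
positive imaginary axis: up to the factor \<open>- \<i>\<close>, it is there the Laplace transform of the characteristic
function, reflected at \<open>0\<close> (\<open>cauchy_transform_eq_laplace_char\<close>), and Laplace transforms of bounded continuous
functions are injective. So it suffices to compare the Cauchy transforms of \<open>Y\<close> and
\<open>X Z powr (1 - 1/\<alpha>)\<close> at \<open>\<i> y\<close> for \<open>y > 0\<close>.

Let \<open>G\<close> be the Cauchy transform of \<open>X\<close>, put \<open>\<Psi> v = \<i> y v + exp (\<i> \<pi> \<alpha> \<rho>) v powr \<alpha>\<close> and consider the
curve \<open>v x = x powr (1/\<alpha>) G (\<i> y x powr (1/\<alpha> - 1))\<close> for \<open>x > 0\<close>, which stays in the lower half-plane.
The free stable law is defined by \<open>z w + exp (\<i> \<pi> \<alpha> \<rho>) w powr \<alpha> = 1\<close> for \<open>w = G z\<close>, and the scaling turns this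
equation into \<open>\<Psi> (v x) = x\<close> (\<open>Psi_curve\<close>). Conditioning on \<open>Z = x\<close>, the weight \<open>x exp (- x)\<close> of the gamma density is
exactly what produces the same curve: the Cauchy transform of the product is the integral of
\<open>exp (- x) v x\<close> over the half-line (\<open>cauchy_transform_gamma_product\<close>). Integration by parts
changes the integrand into \<open>exp (- x) v' x = exp (- \<Psi> (v x)) v' x\<close>, so that the integral becomes the contour
integral of the holomorphic function \<open>exp (- \<Psi> v)\<close> along the curve. Rotating the contour to the negative
imaginary axis \<open>v = - \<i> s\<close> gives \<open>- \<i>\<close> times the integral of \<open>exp (- \<Psi> (- \<i> s))\<close>, and this is the
Cauchy transform of \<open>Y\<close> at \<open>\<i> y\<close>, because
\<open>\<Psi> (- \<i> s) = y s + s powr \<alpha> exp (- \<i> \<pi> \<alpha> (1/2 - \<rho>))\<close>.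

The rotation is legitimate for an elementary reason. Since \<open>\<Psi>\<close> is real on the curve, the argument of
\<open>v x\<close> must lie between \<open>- \<pi> \<rho>\<close> and \<open>- \<pi>/2\<close> (\<open>in_sector_if_Im_Psi_0\<close>), and for such arguments
\<open>Re (\<Psi> v) \<ge> \<kappa> \<bar>v\<bar> powr \<alpha>\<close> with \<open>\<kappa> > 0\<close> (\<open>Re_Psi_ge\<close>). Hence the circular arc from \<open>v x\<close> to
\<open>- \<i> \<bar>v x\<bar>\<close> contributes nothing in the limits \<open>x \<rightarrow> 0\<close> and \<open>x \<rightarrow> \<infinity>\<close> (\<open>arc_estimate\<close>,
\<open>laplace_curve_eq\<close>).
\<close>

section \<open>Integrals over the positive half-line\<close>

text \<open>The endpoints are arbitrary sequences because those of the rotated contour are moduli of points on a curve,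
which may fluctuate.\<close>

lemma truncated_integral_tendsto:
  fixes f :: "real \<Rightarrow> complex" and l u :: "nat \<Rightarrow> real"
  assumes f: "set_integrable lborel {0<..} f"
    and l: "\<And>n. 0 < l n" "l \<longlonglongrightarrow> 0" and u: "filterlim u at_top sequentially"
  shows "(\<lambda>n. LINT x|lborel. indicator {l n..u n} x *\<^sub>R f x)
           \<longlonglongrightarrow> (LINT x:{0<..}|lborel. f x)"
  unfolding set_lebesgue_integral_def
proof (rule integral_dominated_convergence)
  have fm: "(\<lambda>x. indicator {0<..} x *\<^sub>R f x) \<in> borel_measurable lborel"
    using f by (simp add: set_integrable_def)
  then show "(\<lambda>x. indicator {0<..} x *\<^sub>R f x) \<in> borel_measurable lborel" .
  show "integrable lborel (\<lambda>x. norm (indicator {0<..} x *\<^sub>R f x))"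
    using f by (simp only: set_integrable_def integrable_norm)
  show "(\<lambda>x. indicator {l n..u n} x *\<^sub>R f x) \<in> borel_measurable lborel" for n
  proof -
    have "(\<lambda>x. indicator {l n..u n} x *\<^sub>R (indicator {0<..} x *\<^sub>R f x)) \<in> borel_measurable lborel"
      using fm by measurable
    moreover have "(\<lambda>x. indicator {l n..u n} x *\<^sub>R (indicator {0<..} x *\<^sub>R f x))
        = (\<lambda>x. indicator {l n..u n} x *\<^sub>R f x)"
      using l(1)[of n] by (auto simp: indicator_def fun_eq_iff)
    ultimately show ?thesis by simp
  qed
  show "AE x in lborel. norm (indicator {l n..u n} x *\<^sub>R f x) \<le> norm (indicator {0<..} x *\<^sub>R f x)" for n
    using l(1)[of n] by (auto simp: indicator_def)
  show "AE x in lborel. (\<lambda>n. indicator {l n..u n} x *\<^sub>R f x) \<longlonglongrightarrow> indicator {0<..} x *\<^sub>R f x"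
  proof (rule AE_I2)
    fix x :: real
    have "eventually (\<lambda>n. indicator {l n..u n} x *\<^sub>R f x = indicator {0<..} x *\<^sub>R f x) sequentially"
    proof (cases "x > 0")
      case True
      have "eventually (\<lambda>n. l n < x) sequentially"
        using order_tendstoD(2)[OF l(2) True] .
      moreover have "eventually (\<lambda>n. x \<le> u n) sequentially"
        using u by (simp add: filterlim_at_top)
      ultimately show ?thesis
        by eventually_elim (use True in \<open>auto simp: indicator_def\<close>)
    next
      case False
      then have "\<not> l n \<le> x" for n using l(1)[of n] by linarith
      with False show ?thesis by (simp add: indicator_def)
    qed
    then show "(\<lambda>n. indicator {l n..u n} x *\<^sub>R f x) \<longlonglongrightarrow> indicator {0<..} x *\<^sub>R f x"
      by (rule tendsto_eventually)
  qed
qed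

lemma set_integrable_complex_bound:
  fixes f :: "real \<Rightarrow> complex"
  assumes "continuous_on {0<..} f" "set_integrable lborel {0<..} g"
    and "\<And>x. 0 < x \<Longrightarrow> norm (f x) \<le> (g x :: real)"
  shows "set_integrable lborel {0<..} f"
  unfolding set_integrable_def
proof (rule Bochner_Integration.integrable_bound)
  show "integrable lborel (\<lambda>x. indicator {0<..} x *\<^sub>R g x)"
    using assms(2) by (simp add: set_integrable_def)
  show "(\<lambda>x. indicator {0<..} x *\<^sub>R f x) \<in> borel_measurable lborel"
    using borel_measurable_continuous_on_indicator[OF _ assms(1)] by simp
  show "AE x in lborel. norm (indicator {0<..} x *\<^sub>R f x) \<le> norm (indicator {0<..} x *\<^sub>R g x)"
    using assms(3) order_trans[OF _ abs_ge_self] by (intro AE_I2) (auto simp: indicator_def)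
qed

lemma half_line_FTC:
  fixes f F :: "real \<Rightarrow> complex" and l u :: "nat \<Rightarrow> real"
  assumes f: "set_integrable lborel {0<..} f" "continuous_on {0<..} f"
    and F: "\<And>x. 0 < x \<Longrightarrow> (F has_vector_derivative f x) (at x)"
    and l: "\<And>n. 0 < l n" "l \<longlonglongrightarrow> 0" and u: "filterlim u at_top sequentially"
  shows "(\<lambda>n. F (u n) - F (l n)) \<longlonglongrightarrow> (LINT x:{0<..}|lborel. f x)"
proof -
  have "eventually (\<lambda>n. l n < 1) sequentially"
    using order_tendstoD(2)[OF l(2), of 1] by simp
  moreover have "eventually (\<lambda>n. 1 \<le> u n) sequentially"
    using u by (simp add: filterlim_at_top)
  ultimately have "eventually (\<lambda>n. (LINT x|lborel. indicator {l n..u n} x *\<^sub>R f x) = F (u n) - F (l n)) sequentially"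
  proof eventually_elim
    case (elim n)
    show ?case
    proof (rule integral_FTC_atLeastAtMost)
      show "l n \<le> u n" using elim by linarith
      show "(F has_vector_derivative f x) (at x within {l n..u n})" if "l n \<le> x" for x
        using F[of x] l(1)[of n] that has_vector_derivative_at_within by fastforce
      show "continuous_on {l n..u n} f"
        by (rule continuous_on_subset[OF f(2)]) (use l(1)[of n] in auto)
    qed
  qed
  then show ?thesis
    using truncated_integral_tendsto[OF f(1) l u] by (rule Lim_transform_eventually[rotated])
qed

lemma integral_exp_half_line:
  fixes c :: complex
  assumes "0 < Re c"
  shows "(LINT s:{0<..}|lborel. exp (- (c * of_real s))) = 1 / c"
proof -
  have c: "c \<noteq> 0" using assms by auto
  have int: "set_integrable lborel {0<..} (\<lambda>s. exp (- (c * of_real s)))"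
    unfolding set_integrable_def
  proof (rule Bochner_Integration.integrable_bound)
    show "integrable lborel (\<lambda>s. indicator {0<..} s *\<^sub>R exp (- (Re c * s)))"
      using integrable_I0i_exp_mscale[OF assms] by (simp add: set_integrable_def mult.commute)
  qed (auto simp: indicator_def)
  have der: "((\<lambda>s. - exp (- (c * of_real s)) / c) has_vector_derivative exp (- (c * of_real s))) (at s)" for s
    using c by (auto intro!: derivative_eq_intros has_vector_derivative_real_field simp: field_simps)
  let ?F = "\<lambda>s. - exp (- (c * of_real s)) / c"
  have "(\<lambda>n. ?F (real (Suc n)) - ?F (1 / real (Suc n))) \<longlonglongrightarrow> (LINT s:{0<..}|lborel. exp (- (c * of_real s)))"
    by (rule half_line_FTC[OF int _ der])
       (auto intro!: continuous_intros LIMSEQ_Suc[OF lim_1_over_n] filterlim_compose[OF filterlim_real_sequentially filterlim_Suc] simp del: of_nat_Suc)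
  moreover have "(\<lambda>n. ?F (real (Suc n)) - ?F (1 / real (Suc n))) \<longlonglongrightarrow> 0 - ?F 0"
  proof (rule tendsto_diff)
    have "((\<lambda>x. exp (- (Re c * x))) \<longlongrightarrow> 0) at_top"
      using assms by real_asymp
    then have "(\<lambda>n. exp (- (Re c * real (Suc n)))) \<longlonglongrightarrow> 0"
      by (rule filterlim_compose) (rule filterlim_compose[OF filterlim_real_sequentially filterlim_Suc])
    then have "(\<lambda>n. exp (- (c * of_real (real (Suc n))))) \<longlonglongrightarrow> 0"
      by (rule tendsto_norm_zero_cancel[OF tendsto_cong[THEN iffD1, rotated]]) (auto intro!: always_eventually)
    then show "(\<lambda>n. ?F (real (Suc n))) \<longlonglongrightarrow> 0"
      using tendsto_divide[OF tendsto_minus tendsto_const[of c], of "\<lambda>n. exp (- (c * of_real (real (Suc n))))" 0] c by simp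
    have "isCont ?F 0" by (auto intro!: continuous_intros c)
    then show "(\<lambda>n. ?F (1 / real (Suc n))) \<longlonglongrightarrow> ?F 0"
      by (rule isCont_tendsto_compose) (rule LIMSEQ_Suc[OF lim_1_over_n])
  qed
  ultimately show ?thesis
    using LIMSEQ_unique by fastforce
qed

section \<open>The Cauchy transform\<close>

lemma (in prob_space) norm_expectation_le:
  fixes f :: "'a \<Rightarrow> complex"
  assumes "integrable M f" "\<And>x. norm (f x) \<le> B"
  shows "norm (expectation f) \<le> B"
proof -
  have "norm (expectation f) \<le> expectation (\<lambda>x. norm (f x))"
    by (rule integral_norm_bound)
  also have "\<dots> \<le> B"
    using assms by (intro integral_le_const integrable_norm) auto
  finally show ?thesis .
qed

context real_distribution begin

lemma norm_cauchy_kernel_le: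
  assumes "0 < Im z"
  shows "norm (1 / (z - complex_of_real x)) \<le> 1 / Im z"
proof -
  have "Im z \<le> norm (z - of_real x)"
    using abs_Im_le_cmod[of "z - of_real x"] by simp
  then show ?thesis using assms by (simp add: norm_divide frac_le)
qed

lemma integrable_cauchy_kernel:
  assumes "0 < Im z"
  shows "integrable M (\<lambda>x. 1 / (z - complex_of_real x))"
  by (rule integrable_const_bound[where B="1 / Im z"])
     (use norm_cauchy_kernel_le[OF assms] in auto)

lemma norm_cauchy_transform_le:
  assumes "0 < Im z"
  shows "norm (cauchy_transform M z) \<le> 1 / Im z"
  unfolding cauchy_transform_def
  by (rule norm_expectation_le[OF integrable_cauchy_kernel[OF assms] norm_cauchy_kernel_le[OF assms]])

lemma Im_cauchy_transform_neg:
  assumes "0 < Im z"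
  shows "Im (cauchy_transform M z) < 0"
proof -
  have "Im (cauchy_transform M z) = (\<integral>x. Im (1 / (z - complex_of_real x)) \<partial>M)"
    unfolding cauchy_transform_def using integrable_cauchy_kernel[OF assms] by (rule integral_Im[symmetric])
  also have "\<dots> < 0"
  proof (rule expectation_less)
    show "integrable M (\<lambda>x. Im (1 / (z - complex_of_real x)))"
      using integrable_cauchy_kernel[OF assms] by (rule integrable_Im)
    show "AE x in M. Im (1 / (z - complex_of_real x)) < 0"
      using assms by (intro AE_I2) (auto simp: Im_divide sum_power2_gt_zero_iff intro!: divide_neg_pos)
  qed
  finally show ?thesis .
qed

text \<open>The difference quotient of the kernel \<open>1 / (z - x)\<close> differs from its derivative by a term that is \<open>h\<close> times a bound
uniform in \<open>x\<close>, as long as \<open>z + h\<close> keeps at least half the distance of \<open>z\<close> to the real line.\<close>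

lemma has_field_derivative_cauchy_transform:
  assumes z: "0 < Im z"
  shows "(cauchy_transform M has_field_derivative (- (\<integral>x. (1 / (z - complex_of_real x))\<^sup>2 \<partial>M))) (at z)"
proof -
  let ?k = "\<lambda>w x. 1 / (w - complex_of_real x)"
  have sq: "integrable M (\<lambda>x. (?k z x)\<^sup>2)"
    by (rule integrable_const_bound[where B="(1 / Im z)\<^sup>2"])
       (use norm_cauchy_kernel_le[OF z] in \<open>auto simp: norm_power intro!: power_mono\<close>)
  define C where "C = (1 / Im z)\<^sup>2 * (2 / Im z)"
  have bound: "norm ((cauchy_transform M (z + h) - cauchy_transform M z) / h - (- (\<integral>x. (?k z x)\<^sup>2 \<partial>M))) \<le> norm h * C"
    if h: "h \<noteq> 0" "norm h < Im z / 2" for h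
  proof -
    have Imh: "Im z / 2 < Im (z + h)"
      using abs_Im_le_cmod[of h] h by auto
    then have zh: "0 < Im (z + h)" using z by linarith
    have ne: "w - of_real x \<noteq> 0" if "0 < Im w" for w and x :: real
      using that by (metis Im_complex_of_real eq_iff_diff_eq_0 less_irrefl)
    have eq: "(?k (z + h) x - ?k z x) / h + (?k z x)\<^sup>2 = h * ((?k z x)\<^sup>2 * ?k (z + h) x)" for x
    proof -
      define a where "a = z - of_real x"
      have "a \<noteq> 0" "a + h \<noteq> 0" using ne[OF z, of x] ne[OF zh, of x] by (auto simp: a_def algebra_simps)
      then have "(1 / (a + h) - 1 / a) / h + (1 / a)\<^sup>2 = h * ((1 / a)\<^sup>2 * (1 / (a + h)))"
        using h by (simp add: divide_simps power2_eq_square)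
      moreover have "z + h - of_real x = a + h" by (simp add: a_def)
      ultimately show ?thesis by (simp only: a_def[symmetric])
    qed
    have "(cauchy_transform M (z + h) - cauchy_transform M z) / h - (- (\<integral>x. (?k z x)\<^sup>2 \<partial>M))
        = (\<integral>x. (?k (z + h) x - ?k z x) / h + (?k z x)\<^sup>2 \<partial>M)"
      unfolding cauchy_transform_def
      using integrable_cauchy_kernel[OF z] integrable_cauchy_kernel[OF zh] sq by simp
    also have "\<dots> = (\<integral>x. h * ((?k z x)\<^sup>2 * ?k (z + h) x) \<partial>M)"
      by (simp only: eq)
    also have "norm \<dots> \<le> norm h * C"
    proof -
      have nb: "norm (h * ((?k z x)\<^sup>2 * ?k (z + h) x)) \<le> norm h * C" for x
      proof -
        have "norm (?k (z + h) x) \<le> 1 / Im (z + h)" by (rule norm_cauchy_kernel_le[OF zh])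
        also have "\<dots> \<le> 2 / Im z" using Imh z by (simp add: field_simps)
        finally have "norm (?k (z + h) x) \<le> 2 / Im z" .
        moreover have "norm ((?k z x)\<^sup>2) \<le> (1 / Im z)\<^sup>2"
          unfolding norm_power by (rule power_mono[OF norm_cauchy_kernel_le[OF z]]) simp
        ultimately show ?thesis
          unfolding norm_mult C_def by (intro mult_left_mono mult_mono) auto
      qed
      have int: "integrable M (\<lambda>x. h * ((?k z x)\<^sup>2 * ?k (z + h) x))"
        by (rule integrable_const_bound[where B="norm h * C"]) (use nb in auto)
      show ?thesis
        by (rule norm_expectation_le[OF int nb])
    qed
    finally show ?thesis .
  qed
  have "((\<lambda>h. (cauchy_transform M (z + h) - cauchy_transform M z) / h - (- (\<integral>x. (?k z x)\<^sup>2 \<partial>M))) \<longlongrightarrow> 0) (at 0)"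
  proof (rule tendsto_0_le[where K=C and f="\<lambda>h. h"])
    show "((\<lambda>h. h) \<longlongrightarrow> 0) (at (0::complex))" by (rule tendsto_ident_at)
    have "eventually (\<lambda>h. h \<noteq> 0 \<and> norm h < Im z / 2) (at (0::complex))"
      unfolding eventually_at using z by (intro exI[of _ "Im z / 2"]) auto
    then show "eventually (\<lambda>h. norm ((cauchy_transform M (z + h) - cauchy_transform M z) / h - (- (\<integral>x. (?k z x)\<^sup>2 \<partial>M))) \<le> norm h * C) (at 0)"
      by eventually_elim (rule bound, auto)
  qed
  then show ?thesis
    unfolding DERIV_def by (simp only: LIM_zero_iff)
qed

text \<open>The kernel \<open>1 / (\<i> y - x)\<close> is \<open>- \<i>\<close> times the integral of \<open>exp (- (y + \<i> x) s)\<close> over \<open>s > 0\<close>; exchanging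
this integral with the expectation produces the characteristic function.\<close>

lemma cauchy_transform_eq_laplace_char:
  assumes l: "0 < y"
  shows "cauchy_transform M (\<i> * complex_of_real y)
    = - \<i> * (LINT s:{0<..}|lborel. of_real (exp (- (y * s))) * char M (- s))"
proof -
  interpret P: pair_sigma_finite M lborel
    by unfold_locales
  let ?g = "\<lambda>x s. indicator {0<..} s *\<^sub>R exp (- ((of_real y + \<i> * of_real x) * complex_of_real s))"
  have ns: "norm (exp (- ((of_real y + \<i> * of_real x) * complex_of_real s))) = exp (- (y * s))" for x s
    by (simp add: norm_exp_eq_Re)
  have e: "exp (- ((of_real y + \<i> * of_real x) * complex_of_real s)) = of_real (exp (- (y * s))) * iexp (- s * x)" for x s
    by (simp add: exp_of_real[symmetric] exp_add[symmetric] algebra_simps del: exp_of_real)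
  have int: "integrable (M \<Otimes>\<^sub>M lborel) (case_prod ?g)"
  proof (rule P.Fubini_integrable)
    show "case_prod ?g \<in> borel_measurable (M \<Otimes>\<^sub>M lborel)" by measurable
    have "(\<integral>s. norm (?g x s) \<partial>lborel) = (\<integral>s. indicator {0<..} s *\<^sub>R exp (- (y * s)) \<partial>lborel)" for x
      by (intro Bochner_Integration.integral_cong) (auto simp: ns)
    then show "integrable M (\<lambda>x. \<integral>s. norm (case_prod ?g (x, s)) \<partial>lborel)"
      by simp
    have "integrable lborel (?g x)" for x
    proof (rule Bochner_Integration.integrable_bound)
      show "integrable lborel (\<lambda>s. indicator {0<..} s *\<^sub>R exp (- (y * s)))"
        using integrable_I0i_exp_mscale[OF l] by (simp add: set_integrable_def mult.commute)
    qed (auto simp: ns)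
    then show "AE x in M. integrable lborel (\<lambda>s. case_prod ?g (x, s))" by simp
  qed
  have "cauchy_transform M (\<i> * complex_of_real y) = (\<integral>x. - \<i> * (LINT s:{0<..}|lborel. exp (- ((of_real y + \<i> * of_real x) * complex_of_real s))) \<partial>M)"
    unfolding cauchy_transform_def
  proof (rule Bochner_Integration.integral_cong)
    fix x
    have "(of_real y + \<i> * complex_of_real x) \<noteq> 0" using l by (auto simp: complex_eq_iff)
    moreover have "\<i> * of_real y - of_real x = \<i> * (of_real y + \<i> * complex_of_real x)"
      by (simp add: algebra_simps)
    ultimately show "1 / (\<i> * of_real y - of_real x) = - \<i> * (LINT s:{0<..}|lborel. exp (- ((of_real y + \<i> * complex_of_real x) * complex_of_real s)))"
      using l by (subst integral_exp_half_line) (auto simp: field_simps)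
  qed simp
  also have "\<dots> = - \<i> * (\<integral>x. (\<integral>s. ?g x s \<partial>lborel) \<partial>M)"
    by (simp add: set_lebesgue_integral_def)
  also have "(\<integral>x. (\<integral>s. ?g x s \<partial>lborel) \<partial>M) = (\<integral>s. (\<integral>x. ?g x s \<partial>M) \<partial>lborel)"
    by (rule P.Fubini_integral[OF int, symmetric])
  also have "\<dots> = (LINT s:{0<..}|lborel. of_real (exp (- (y * s))) * char M (- s))"
    unfolding set_lebesgue_integral_def e char_def by (simp add: indicator_def)
  finally show ?thesis .
qed

end

section \<open>Injectivity of the Laplace transform\<close>

lemma laplace_exp_poly_eq_0:
  fixes h :: "real \<Rightarrow> real"
  assumes int: "\<And>n. set_integrable lborel {0<..} (\<lambda>s. exp (- (real (Suc n) * s)) * h s)"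
    and 0: "\<And>n. (LINT s:{0<..}|lborel. exp (- (real (Suc n) * s)) * h s) = 0"
  shows "set_integrable lborel {0<..} (\<lambda>s. exp (- s) * (\<Sum>i\<le>m. a i * exp (- s) ^ i) * h s)"
    and "(LINT s:{0<..}|lborel. exp (- s) * (\<Sum>i\<le>m. a i * exp (- s) ^ i) * h s) = 0"
proof -
  have eq: "exp (- s) * (\<Sum>i\<le>m. a i * exp (- s) ^ i) * h s
      = (\<Sum>i\<le>m. a i * (exp (- (real (Suc i) * s)) * h s))" for s
    by (simp add: sum_distrib_left sum_distrib_right exp_of_nat_mult[symmetric] mult_exp_exp algebra_simps)
  show "set_integrable lborel {0<..} (\<lambda>s. exp (- s) * (\<Sum>i\<le>m. a i * exp (- s) ^ i) * h s)"
    using int unfolding eq set_integrable_def scaleR_sum_right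
    by (intro Bochner_Integration.integrable_sum)
       (simp add: scaleR_conv_of_real mult.left_commute[of "indicator _ _"] del: of_nat_Suc)
  show "(LINT s:{0<..}|lborel. exp (- s) * (\<Sum>i\<le>m. a i * exp (- s) ^ i) * h s) = 0"
    using int 0 unfolding eq set_integrable_def set_lebesgue_integral_def scaleR_sum_right
    by (subst Bochner_Integration.integral_sum)
       (simp_all add: scaleR_conv_of_real mult.left_commute[of "indicator _ _"] del: of_nat_Suc)
qed

text \<open>The values of the Laplace transform at the positive integers say that \<open>h\<close>, in the variable \<open>u = exp (- s)\<close>, is
orthogonal to all polynomials on \<open>{0..1}\<close>. The function \<open>u * h (- ln u)\<close> extends continuously to \<open>u = 0\<close>, so it is
a uniform limit of polynomials and therefore orthogonal to \<open>h\<close> itself, which makes a weighted \<open>L\<^sup>2\<close> norm of \<open>h\<close> vanish.\<close>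

lemma laplace_transform_eq_0_real:
  fixes h :: "real \<Rightarrow> real"
  assumes cont: "continuous_on UNIV h" and bdd: "\<And>s. \<bar>h s\<bar> \<le> C"
    and 0: "\<And>n. (LINT s:{0<..}|lborel. exp (- (real (Suc n) * s)) * h s) = 0"
    and s: "0 < s"
  shows "h s = 0"
proof -
  have Cnn: "0 \<le> C" using bdd[of 1] by linarith
  have meas: "set_borel_measurable lborel {0<..} (\<lambda>s. k s * h s)" if "continuous_on {0<..} k" for k
    unfolding set_borel_measurable_def
    using borel_measurable_continuous_on_indicator[of "{0<..}" "\<lambda>s. k s * h s"] that continuous_on_subset[OF cont, of "{0<..}"]
    by (auto intro!: continuous_intros)
  have int: "set_integrable lborel {0<..} (\<lambda>s. exp (- s) * k s * h s)"
    if k: "continuous_on {0<..} k" "\<And>s. 0 < s \<Longrightarrow> \<bar>k s\<bar> \<le> B" for k B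
    unfolding set_integrable_def
  proof (rule Bochner_Integration.integrable_bound)
    show "integrable lborel (\<lambda>s. indicator {0<..} s *\<^sub>R (exp (- (s * 1)) * (B * C)))"
      using set_integrable_mult_left[of "B * C", OF integrable_I0i_exp_mscale[of 1]]
      by (simp add: set_integrable_def)
    show "(\<lambda>s. indicator {0<..} s *\<^sub>R (exp (- s) * k s * h s)) \<in> borel_measurable lborel"
      using meas[of "\<lambda>s. exp (- s) * k s", OF continuous_on_mult[OF _ k(1)]]
      by (simp add: set_borel_measurable_def continuous_intros)
    have "\<bar>k s\<bar> * \<bar>h s\<bar> \<le> B * C" if "0 < s" for s
      using k(2)[OF that] bdd[of s] by (intro mult_mono) auto
    then have "\<bar>k s\<bar> * \<bar>h s\<bar> \<le> \<bar>B * C\<bar>" if "0 < s" for s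
      using that by (meson abs_ge_self order_trans)
    then show "AE s in lborel. norm (indicator {0<..} s *\<^sub>R (exp (- s) * k s * h s))
        \<le> norm (indicator {0<..} s *\<^sub>R (exp (- (s * 1)) * (B * C)))"
      by (intro AE_I2) (auto simp: indicator_def abs_mult mult.assoc)
  qed
  have intn: "set_integrable lborel {0<..} (\<lambda>s. exp (- (real (Suc n) * s)) * h s)" for n
  proof -
    have "set_integrable lborel {0<..} (\<lambda>s. exp (- s) * exp (- (real n * s)) * h s)"
      by (rule int[where B=1]) (auto intro!: continuous_intros)
    then show ?thesis by (simp add: mult_exp_exp algebra_simps)
  qed
  define g where "g u = (if u = 0 then 0 else u * h (- ln u))" for u
  have gh: "g (exp (- s)) = exp (- s) * h s" for s
    by (simp add: g_def)
  have contg: "continuous_on {0..1} g"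
  proof (rule continuous_at_imp_continuous_on, rule ballI)
    fix u :: real assume "u \<in> {0..1}"
    show "isCont g u"
    proof (cases "u = 0")
      case True
      have "(g \<longlongrightarrow> 0) (at 0)"
      proof (rule tendsto_0_le[where K=C and f="\<lambda>u. u"])
        show "eventually (\<lambda>u. norm (g u) \<le> norm u * C) (at 0)"
          using bdd by (auto simp: g_def abs_mult intro!: always_eventually mult_left_mono)
      qed (rule tendsto_ident_at)
      then show ?thesis using True by (simp add: isCont_def g_def)
    next
      case False
      with \<open>u \<in> {0..1}\<close> have u: "0 < u" by auto
      have "isCont h x" for x
        using cont by (simp add: continuous_on_eq_continuous_at)
      then have "isCont (\<lambda>u. u * h (- ln u)) u"
        using u by (intro continuous_intros isCont_o2[of u "\<lambda>u. - ln u" h]) auto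
      moreover have "eventually (\<lambda>u. u * h (- ln u) = g u) (nhds u)"
        using eventually_nhds_in_open[of "{0<..}" u] u
        by (auto simp: g_def elim!: eventually_mono)
      ultimately show ?thesis by (rule isCont_cong[THEN iffD1, rotated])
    qed
  qed
  define J where "J = (LINT s:{0<..}|lborel. exp (- s) * (exp (- s) * h s) * h s)"
  have int_sq: "set_integrable lborel {0<..} (\<lambda>s. exp (- s) * (exp (- s) * h s) * h s)"
  proof (rule int[where B=C])
    show "continuous_on {0<..} (\<lambda>s. exp (- s) * h s)"
      using continuous_on_subset[OF cont, of "{0<..}"] by (auto intro!: continuous_intros)
    show "\<bar>exp (- s) * h s\<bar> \<le> C" if "0 < s" for s
      using mult_mono[of "exp (- s)" 1 "\<bar>h s\<bar>" C] bdd[of s] that by (simp add: abs_mult)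
  qed
  \<comment> \<open>by orthogonality, replacing \<open>g\<close> by \<open>g - p\<close> for a polynomial \<open>p\<close> leaves \<open>J\<close> unchanged\<close>
  have J_le: "J \<le> e * C" if e: "0 < e" for e
  proof -
    obtain p where p: "real_polynomial_function p" "\<And>u. u \<in> {0..1} \<Longrightarrow> \<bar>g u - p u\<bar> < e"
      using Stone_Weierstrass_real_polynomial_function[OF _ contg e] by auto
    obtain a m where pe: "p = (\<lambda>u. \<Sum>i\<le>m. a i * u ^ i)"
      using p(1) by (auto simp: real_polynomial_function_iff_sum)
    note P = laplace_exp_poly_eq_0[OF intn 0, where a=a and m=m]
    have "J = (LINT s:{0<..}|lborel. exp (- s) * (exp (- s) * h s) * h s)
            - (LINT s:{0<..}|lborel. exp (- s) * p (exp (- s)) * h s)"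
      using P(2) by (simp add: J_def pe)
    also have "\<dots> = (LINT s:{0<..}|lborel. exp (- s) * (exp (- s) * h s) * h s - exp (- s) * p (exp (- s)) * h s)"
      using P(1) int_sq by (intro set_integral_diff(2)[symmetric]) (simp_all add: pe)
    also have "\<dots> \<le> (LINT s:{0<..}|lborel. exp (- (1 * s)) * (e * C))"
    proof (rule set_integral_mono)
      show "set_integrable lborel {0<..} (\<lambda>s. exp (- s) * (exp (- s) * h s) * h s - exp (- s) * p (exp (- s)) * h s)"
        using P(1) int_sq by (intro set_integral_diff(1)) (simp_all add: pe)
      show "set_integrable lborel {0<..} (\<lambda>s. exp (- (1 * s)) * (e * C))"
        using integrable_I0i_exp_mscale[of 1] by (intro set_integrable_mult_left) (simp add: mult.commute)
      fix s :: real assume "s \<in> {0<..}"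
      then have "\<bar>g (exp (- s)) - p (exp (- s))\<bar> \<le> e"
        using p(2)[of "exp (- s)"] by simp
      then have "\<bar>(g (exp (- s)) - p (exp (- s))) * h s\<bar> \<le> e * C"
        unfolding abs_mult using bdd[of s] e by (intro mult_mono) auto
      then have "(g (exp (- s)) - p (exp (- s))) * h s \<le> e * C" by linarith
      then have "exp (- s) * ((g (exp (- s)) - p (exp (- s))) * h s) \<le> exp (- s) * (e * C)"
        by (rule mult_left_mono) simp
      then show "exp (- s) * (exp (- s) * h s) * h s - exp (- s) * p (exp (- s)) * h s
          \<le> exp (- (1 * s)) * (e * C)"
        by (simp add: gh algebra_simps)
    qed
    also have "\<dots> = e * C"
      using set_integral_complex_of_real[of lborel "{0<..}" "\<lambda>s. exp (- s)"] integral_exp_half_line[of 1]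
      by (simp add: exp_of_real[symmetric] del: exp_of_real)
    finally show ?thesis .
  qed
  have "J \<le> 0"
  proof (rule field_le_epsilon)
    fix e :: real assume "0 < e"
    then have "J \<le> e / (C + 1) * C" using Cnn by (intro J_le) auto
    also have "\<dots> \<le> e" using \<open>0 < e\<close> Cnn by (simp add: field_simps)
    finally show "J \<le> 0 + e" by simp
  qed
  show ?thesis
  proof (rule ccontr)
    assume "h s \<noteq> 0"
    let ?q = "\<lambda>t. indicator {0<..} t *\<^sub>R (exp (- t) * (exp (- t) * h t) * h t)"
    have q0: "0 \<le> ?q t" for t
      by (auto simp: indicator_def mult.assoc)
    have "0 \<le> integral\<^sup>L lborel ?q"
      by (rule Bochner_Integration.integral_nonneg) (rule q0)
    then have "integral\<^sup>L lborel ?q = 0"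
      using \<open>J \<le> 0\<close> by (simp add: J_def set_lebesgue_integral_def)
    then have "AE t in lborel. ?q t = 0"
      using integral_nonneg_eq_0_iff_AE[of lborel ?q] int_sq q0 by (simp add: set_integrable_def)
    then have "AE t in lborel. t \<in> {..0} \<union> h -` {0}"
      by eventually_elim (auto simp: indicator_def split: if_splits)
    moreover have "closed ({..0} \<union> h -` {0})"
      using cont by (intro closed_Un closed_vimage) auto
    ultimately have "s \<in> {..0} \<union> h -` {0}"
      by (intro mem_closed_if_AE_lebesgue) (auto simp: AE_completion_iff)
    then show False using s \<open>h s \<noteq> 0\<close> by auto
  qed
qed

lemma laplace_transform_injective:
  fixes f g :: "real \<Rightarrow> complex"
  assumes cont: "continuous_on UNIV f" "continuous_on UNIV g"
    and bdd: "\<And>s. norm (f s) \<le> B" "\<And>s. norm (g s) \<le> C"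
    and eq: "\<And>y. 0 < y \<Longrightarrow> (LINT s:{0<..}|lborel. of_real (exp (- (y * s))) * f s)
                        = (LINT s:{0<..}|lborel. of_real (exp (- (y * s))) * g s)"
    and s: "0 < s"
  shows "f s = g s"
proof -
  have int: "set_integrable lborel {0<..} (\<lambda>s. complex_of_real (exp (- (y * s))) * k s)"
    if k: "continuous_on UNIV k" "\<And>s. norm (k s) \<le> D" and y: "0 < y" for y k D
    unfolding set_integrable_def
  proof (rule Bochner_Integration.integrable_bound)
    show "integrable lborel (\<lambda>s. indicator {0<..} s *\<^sub>R (exp (- (s * y)) * D))"
      using set_integrable_mult_left[of D, OF integrable_I0i_exp_mscale[OF y]]
      by (simp add: set_integrable_def)
    have "continuous_on {0<..} (\<lambda>s. complex_of_real (exp (- (y * s))) * k s)"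
      using continuous_on_subset[OF k(1)] by (auto intro!: continuous_intros)
    then show "(\<lambda>s. indicator {0<..} s *\<^sub>R (complex_of_real (exp (- (y * s))) * k s)) \<in> borel_measurable lborel"
      using borel_measurable_continuous_on_indicator[of "{0<..}" "\<lambda>s. complex_of_real (exp (- (y * s))) * k s"] by simp
    have "norm (k s) \<le> \<bar>D\<bar>" for s using k(2)[of s] by linarith
    then show "AE s in lborel. norm (indicator {0<..} s *\<^sub>R (complex_of_real (exp (- (y * s))) * k s))
        \<le> norm (indicator {0<..} s *\<^sub>R (exp (- (s * y)) * D))"
      by (intro AE_I2) (auto simp: indicator_def norm_mult abs_mult mult.commute)
  qed
  have diff: "(LINT s:{0<..}|lborel. complex_of_real (exp (- (y * s))) * (f s - g s)) = 0"
    and idiff: "integrable lborel (\<lambda>s. indicator {0<..} s *\<^sub>R (complex_of_real (exp (- (y * s))) * (f s - g s)))" if y: "0 < y" for y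
    using eq[OF y] int[OF cont(1) bdd(1) y] int[OF cont(2) bdd(2) y]
    by (simp_all add: right_diff_distrib set_integral_diff set_integrable_def[symmetric])
  have bd: "norm (f s - g s) \<le> B + C" for s
    using norm_triangle_ineq4[of "f s" "g s"] bdd(1)[of s] bdd(2)[of s] by linarith
  have "Re (f s - g s) = 0"
  proof (rule laplace_transform_eq_0_real[where C="B + C", OF _ _ _ s])
    show "continuous_on UNIV (\<lambda>s. Re (f s - g s))"
      using cont by (auto intro!: continuous_intros)
    show "\<bar>Re (f s - g s)\<bar> \<le> B + C" for s
      using abs_Re_le_cmod[of "f s - g s"] bd[of s] by linarith
    show "(LINT s:{0<..}|lborel. exp (- (real (Suc n) * s)) * Re (f s - g s)) = 0" for n
      using arg_cong[OF diff[of "real (Suc n)"], of Re] integral_Re[OF idiff[of "real (Suc n)"]]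
      by (simp add: set_lebesgue_integral_def del: of_nat_Suc minus_complex.sel)
  qed
  moreover have "Im (f s - g s) = 0"
  proof (rule laplace_transform_eq_0_real[where C="B + C", OF _ _ _ s])
    show "continuous_on UNIV (\<lambda>s. Im (f s - g s))"
      using cont by (auto intro!: continuous_intros)
    show "\<bar>Im (f s - g s)\<bar> \<le> B + C" for s
      using abs_Im_le_cmod[of "f s - g s"] bd[of s] by linarith
    show "(LINT s:{0<..}|lborel. exp (- (real (Suc n) * s)) * Im (f s - g s)) = 0" for n
      using arg_cong[OF diff[of "real (Suc n)"], of Im] integral_Im[OF idiff[of "real (Suc n)"]]
      by (simp add: set_lebesgue_integral_def del: of_nat_Suc minus_complex.sel)
  qed
  ultimately show ?thesis by (simp add: complex_eq_iff)
qed

lemma char_minus: "char M (- t) = cnj (char M t)"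
  unfolding char_def by (subst Bochner_Integration.integral_cnj[symmetric]) (simp add: exp_cnj)

lemma real_distribution_eq_if_cauchy_transform_eq:
  assumes "real_distribution M1" "real_distribution M2"
    and eq: "\<And>y. 0 < y \<Longrightarrow> cauchy_transform M1 (\<i> * complex_of_real y) = cauchy_transform M2 (\<i> * complex_of_real y)"
  shows "M1 = M2"
proof (rule Levy_uniqueness[OF assms(1,2)])
  interpret M1: real_distribution M1 by fact
  interpret M2: real_distribution M2 by fact
  have neg: "char M1 (- s) = char M2 (- s)" if "0 < s" for s
  proof (rule laplace_transform_injective[where f="\<lambda>s. char M1 (- s)" and g="\<lambda>s. char M2 (- s)" and B=1 and C=1, OF _ _ _ _ _ that])
    show "continuous_on UNIV (\<lambda>s. char M1 (- s))"
      by (intro continuous_at_imp_continuous_on ballI isCont_o2[OF _ M1.isCont_char]) auto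
    show "continuous_on UNIV (\<lambda>s. char M2 (- s))"
      by (intro continuous_at_imp_continuous_on ballI isCont_o2[OF _ M2.isCont_char]) auto
    show "(LINT s:{0<..}|lborel. of_real (exp (- (y * s))) * char M1 (- s))
        = (LINT s:{0<..}|lborel. of_real (exp (- (y * s))) * char M2 (- s))" if "0 < y" for y
      using eq[OF that] by (simp add: M1.cauchy_transform_eq_laplace_char[OF that] M2.cauchy_transform_eq_laplace_char[OF that])
  qed (rule M1.cmod_char_le_1 M2.cmod_char_le_1)+
  show "char M1 = char M2"
  proof
    fix t :: real
    consider "t = 0" | "t < 0" | "0 < t" by linarith
    then show "char M1 t = char M2 t"
    proof cases
      case 1 then show ?thesis by (simp add: M1.char_zero M2.char_zero)
    next
      case 2 then show ?thesis using neg[of "- t"] by simp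
    next
      case 3 then show ?thesis using neg[of t] by (metis char_minus complex_cnj_cancel_iff)
    qed
  qed
qed

section \<open>The exponent of the stable law in the lower half-plane\<close>

text \<open>The parameter \<open>y\<close> is the height of the point \<open>\<i> y\<close> at which the Cauchy transforms are compared.\<close>

locale stable_exponent =
  fixes \<alpha> \<rho> y :: real
  assumes admissible: "(\<alpha>, \<rho>) \<in> admissible_params" and y_pos: "0 < y"
begin

text \<open>The classical law enters through \<open>exp (- \<Psi> (- \<i> s))\<close>, which is \<open>exp (- y s)\<close> times its characteristic function
at \<open>- s\<close>; the free law enters through the equation \<open>\<Psi> v = x\<close> for its scaled Cauchy transform.\<close>

definition \<Psi> :: "complex \<Rightarrow> complex" where
  "\<Psi> v = \<i> * of_real y * v + exp (\<i> * of_real (pi * \<alpha> * \<rho>)) * v powr of_real \<alpha>"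

text \<open>This is the real part of the coefficient of \<open>s powr \<alpha>\<close> in \<open>\<Psi> (- \<i> s)\<close>.\<close>

definition \<kappa> :: real where
  "\<kappa> = cos (pi * (\<alpha> * \<bar>\<rho> - 1/2\<bar>))"

lemma alpha_pos: "0 < \<alpha>"
  using admissible by (auto simp: admissible_params_def)

text \<open>This bound makes \<open>\<kappa>\<close> positive; for \<open>\<alpha> > 1\<close> the narrower range of \<open>\<rho>\<close> compensates for the larger factor \<open>\<alpha>\<close>.\<close>

lemma angle_less: "\<alpha> * \<bar>\<rho> - 1/2\<bar> < 1/2"
proof (cases "\<alpha> < 1")
  case True
  then have "0 \<le> \<rho>" "\<rho> \<le> 1"
    using admissible by (auto simp: admissible_params_def)
  then have "\<bar>\<rho> - 1/2\<bar> \<le> 1/2" by linarith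
  then have "\<alpha> * \<bar>\<rho> - 1/2\<bar> \<le> \<alpha> * (1/2)"
    using alpha_pos by (intro mult_left_mono) auto
  then show ?thesis using True by simp
next
  case False
  then have a: "1 < \<alpha>" "1 - 1 / \<alpha> \<le> \<rho>" "\<rho> \<le> 1 / \<alpha>"
    using admissible by (auto simp: admissible_params_def)
  then have "\<bar>\<rho> - 1/2\<bar> \<le> 1 / \<alpha> - 1/2" by linarith
  then have "\<alpha> * \<bar>\<rho> - 1/2\<bar> \<le> \<alpha> * (1 / \<alpha> - 1/2)"
    using alpha_pos by (intro mult_left_mono) auto
  also have "\<dots> = 1 - \<alpha> / 2" using a by (simp add: field_simps)
  finally show ?thesis using a by linarith
qed

lemma kappa_pos: "0 < \<kappa>"
proof -
  have "pi * (\<alpha> * \<bar>\<rho> - 1/2\<bar>) < pi * (1/2)"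
    using angle_less by (intro mult_strict_left_mono) auto
  moreover have "0 \<le> pi * (\<alpha> * \<bar>\<rho> - 1/2\<bar>)" using alpha_pos by simp
  ultimately show ?thesis unfolding \<kappa>_def using pi_gt_zero by (intro cos_gt_zero_pi) linarith+
qed

lemma Psi_rcis:
  assumes "0 < r" "- pi < a" "a \<le> pi"
  shows "Re (\<Psi> (rcis r a)) = r powr \<alpha> * cos (\<alpha> * (pi * \<rho> + a)) - y * r * sin a"
    and "Im (\<Psi> (rcis r a)) = y * r * cos a + r powr \<alpha> * sin (\<alpha> * (pi * \<rho> + a))"
proof -
  have "rcis r a = exp (of_real (ln r) + \<i> * of_real a)"
    using assms by (simp add: rcis_def cis_conv_exp exp_add exp_of_real)
  then have "Ln (rcis r a) = of_real (ln r) + \<i> * of_real a"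
    using assms by (simp add: Ln_exp)
  then have "exp (\<i> * of_real (pi * \<alpha> * \<rho>)) * rcis r a powr of_real \<alpha>
      = exp (\<i> * of_real (pi * \<alpha> * \<rho>)) * exp (of_real \<alpha> * (of_real (ln r) + \<i> * of_real a))"
    using assms by (simp add: powr_def)
  also have "\<dots> = exp (of_real (\<alpha> * ln r) + \<i> * of_real (\<alpha> * (pi * \<rho> + a)))"
    by (simp add: exp_add[symmetric] algebra_simps)
  also have "\<dots> = rcis (r powr \<alpha>) (\<alpha> * (pi * \<rho> + a))"
    using assms by (simp add: rcis_def cis_conv_exp exp_add exp_of_real[symmetric] powr_def del: exp_of_real)
  finally show "Re (\<Psi> (rcis r a)) = r powr \<alpha> * cos (\<alpha> * (pi * \<rho> + a)) - y * r * sin a"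
    "Im (\<Psi> (rcis r a)) = y * r * cos a + r powr \<alpha> * sin (\<alpha> * (pi * \<rho> + a))"
    by (simp_all add: \<Psi>_def)
qed

text \<open>The ball consists of the angles that are no farther from \<open>- \<pi> \<rho>\<close> than \<open>- \<pi>/2\<close> is. It contains the interval between
these two angles; taking both sides avoids a distinction by the sign of \<open>\<rho> - 1/2\<close>, and only the distance to
\<open>- \<pi> \<rho>\<close> matters for the lower bound on \<open>Re \<Psi>\<close>.\<close>

definition sector :: "real set" where
  "sector = {- pi<..<0} \<inter> cball (- (pi * \<rho>)) (pi * \<bar>\<rho> - 1/2\<bar>)"

lemma convex_sector: "convex sector"
  unfolding sector_def by (intro convex_Int convex_cball convex_real_interval)

lemma minus_half_pi_in_sector: "- (pi / 2) \<in> sector"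
proof -
  have "\<bar>- (pi * \<rho>) - - (pi / 2)\<bar> = \<bar>pi * (1/2 - \<rho>)\<bar>" by (simp add: algebra_simps)
  also have "\<dots> = pi * \<bar>\<rho> - 1/2\<bar>" by (simp add: abs_mult abs_minus_commute)
  finally show ?thesis by (simp add: sector_def dist_real_def)
qed

text \<open>The linear term of \<open>\<Psi>\<close> has nonnegative real part in the lower half-plane. The angle of the other term is at most
\<open>\<alpha>\<close> times the radius of the ball, which is the angle whose cosine is \<open>\<kappa>\<close>.\<close>

lemma Re_Psi_ge:
  assumes r: "0 < r" and a: "a \<in> sector"
  shows "\<kappa> * r powr \<alpha> \<le> Re (\<Psi> (rcis r a))"
proof -
  have a': "- pi < a" "a < 0" "\<bar>pi * \<rho> + a\<bar> \<le> pi * \<bar>\<rho> - 1/2\<bar>"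
    using a by (auto simp: sector_def dist_real_def)
  have "\<bar>\<alpha> * (pi * \<rho> + a)\<bar> \<le> \<alpha> * (pi * \<bar>\<rho> - 1/2\<bar>)"
    unfolding abs_mult using a'(3) alpha_pos by (simp add: mult_left_mono)
  also have "\<dots> = pi * (\<alpha> * \<bar>\<rho> - 1/2\<bar>)" by simp
  finally have le: "\<bar>\<alpha> * (pi * \<rho> + a)\<bar> \<le> pi * (\<alpha> * \<bar>\<rho> - 1/2\<bar>)" .
  have "pi * (\<alpha> * \<bar>\<rho> - 1/2\<bar>) \<le> pi * 1"
    using angle_less by (intro mult_left_mono) auto
  then have "\<kappa> \<le> cos \<bar>\<alpha> * (pi * \<rho> + a)\<bar>"
    unfolding \<kappa>_def using le by (intro cos_monotone_0_pi_le) auto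
  then have "\<kappa> * r powr \<alpha> \<le> r powr \<alpha> * cos (\<alpha> * (pi * \<rho> + a))"
    unfolding cos_abs_real using mult_left_mono[of \<kappa> _ "r powr \<alpha>"]
    by (subst mult.commute) simp
  moreover have "sin a < 0"
    using a' sin_gt_zero[of "- a"] by simp
  then have "y * r * sin a \<le> 0"
    using r y_pos by (simp add: mult_nonneg_nonpos)
  moreover have "a \<le> pi" using a' pi_gt_zero by linarith
  ultimately show ?thesis
    using Psi_rcis(1)[OF r a'(1)] by linarith
qed

text \<open>If \<open>\<Psi>\<close> is real, its two imaginary parts \<open>y r cos a\<close> and \<open>r powr \<alpha> sin (\<alpha> (\<pi> \<rho> + a))\<close> cancel. The sign of the first
shows on which side of \<open>- \<pi>/2\<close> the angle \<open>a\<close> lies. Admissibility puts \<open>\<alpha> (\<pi> \<rho> + a)\<close> strictly between \<open>- \<pi>\<close> and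
\<open>\<pi>\<close>, so that the sign of the second shows on which side of \<open>- \<pi> \<rho>\<close> it lies. Thus \<open>a\<close> is between the two.\<close>

lemma in_sector_if_Im_Psi_0:
  assumes r: "0 < r" and a: "- pi < a" "a < 0" and 0: "Im (\<Psi> (rcis r a)) = 0"
  shows "a \<in> sector"
proof -
  have pa: "a \<le> pi" using a pi_gt_zero by linarith
  define b where "b = pi * \<rho> + a"
  have eq: "y * r * cos a + r powr \<alpha> * sin (\<alpha> * b) = 0"
    using Psi_rcis(2)[OF r a(1) pa] 0 by (simp add: b_def)
  have ab: "- pi < \<alpha> * b" "\<alpha> * b < pi"
  proof -
    have "\<alpha> * \<rho> \<le> 1" "\<alpha> * (1 - \<rho>) \<le> 1"
    proof -
      have "\<alpha> * \<rho> \<le> 1 \<and> \<alpha> * (1 - \<rho>) \<le> 1"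
      proof (cases "\<alpha> < 1")
        case True
        then have "0 \<le> \<rho>" "\<rho> \<le> 1" using admissible by (auto simp: admissible_params_def)
        then show ?thesis using True alpha_pos by (auto intro!: mult_le_one)
      next
        case False
        then have "1 - 1 / \<alpha> \<le> \<rho>" "\<rho> \<le> 1 / \<alpha>"
          using admissible by (auto simp: admissible_params_def)
        then show ?thesis using alpha_pos by (simp add: field_simps)
      qed
      then show "\<alpha> * \<rho> \<le> 1" "\<alpha> * (1 - \<rho>) \<le> 1" by auto
    qed
    then have "pi * (\<alpha> * \<rho>) \<le> pi * 1" "pi * (\<alpha> * (1 - \<rho>)) \<le> pi * 1"
      by (auto intro!: mult_left_mono simp del: mult_1_right)
    moreover have "\<alpha> * a < 0" "0 < \<alpha> * (pi + a)"
      using alpha_pos a by (auto intro: mult_pos_neg)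
    moreover have "\<alpha> * b = pi * (\<alpha> * \<rho>) + \<alpha> * a" "\<alpha> * b = \<alpha> * (pi + a) - pi * (\<alpha> * (1 - \<rho>))"
      by (simp_all add: b_def algebra_simps)
    ultimately show "- pi < \<alpha> * b" "\<alpha> * b < pi"
      by linarith+
  qed
  have "\<bar>b\<bar> \<le> pi * \<bar>\<rho> - 1/2\<bar>"
  proof -
    have neg: "b < 0" if "sin (\<alpha> * b) < 0"
    proof (rule ccontr)
      assume "\<not> b < 0"
      then have "0 \<le> sin (\<alpha> * b)" using ab alpha_pos by (intro sin_ge_zero) auto
      with that show False by simp
    qed
    have pos: "0 < b" if "0 < sin (\<alpha> * b)"
    proof (rule ccontr)
      assume "\<not> 0 < b"
      then have "0 \<le> sin (- (\<alpha> * b))"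
        using ab alpha_pos by (intro sin_ge_zero) (auto simp: mult_nonneg_nonpos)
      with that show False by simp
    qed
    have rp: "0 < r powr \<alpha>" "0 < y * r" using r y_pos by auto
    have half: "pi * (\<rho> - 1/2) \<le> pi * \<bar>\<rho> - 1/2\<bar>" "pi * (1/2 - \<rho>) \<le> pi * \<bar>\<rho> - 1/2\<bar>"
      by (auto intro!: mult_left_mono)
    consider "- (pi / 2) < a" | "a < - (pi / 2)" | "a = - (pi / 2)" by linarith
    then show ?thesis
    proof cases
      case 1
      then have "0 < cos a" using a pi_gt_zero by (intro cos_gt_zero_pi) linarith+
      with rp(2) have "0 < y * r * cos a" by (rule mult_pos_pos)
      then have "0 < r powr \<alpha> * (- sin (\<alpha> * b))" using eq by linarith
      then have "0 < - sin (\<alpha> * b)" using rp(1) by (rule zero_less_mult_pos)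
      then have "b < 0" using neg by simp
      moreover have "- b < pi * (1/2 - \<rho>)" using 1 unfolding b_def right_diff_distrib by linarith
      ultimately show ?thesis using half by linarith
    next
      case 2
      then have "0 < cos (a + pi)" using a pi_gt_zero by (intro cos_gt_zero_pi) linarith+
      then have "cos a < 0" by simp
      with rp(2) have "y * r * cos a < 0" by (rule mult_pos_neg)
      then have "0 < r powr \<alpha> * sin (\<alpha> * b)" using eq by linarith
      then have "0 < sin (\<alpha> * b)" using rp(1) by (rule zero_less_mult_pos)
      then have "0 < b" by (rule pos)
      moreover have "b < pi * (\<rho> - 1/2)" using 2 unfolding b_def right_diff_distrib by linarith
      ultimately show ?thesis using half by linarith
    next
      case 3
      then have "b = pi * (\<rho> - 1/2)" unfolding b_def right_diff_distrib by linarith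
      then show ?thesis by (simp add: abs_mult)
    qed
  qed
  moreover have "\<bar>- (pi * \<rho>) - a\<bar> = \<bar>b\<bar>" by (simp add: b_def)
  ultimately show ?thesis using a by (simp add: sector_def dist_real_def)
qed

lemma norm_Psi_le: "norm (\<Psi> v) \<le> y * norm v + norm v powr \<alpha>"
proof -
  have "norm (v powr of_real \<alpha>) = norm v powr \<alpha>"
    by (simp add: norm_powr_real_powr')
  then have "norm (exp (\<i> * of_real (pi * \<alpha> * \<rho>)) * v powr of_real \<alpha>) = norm v powr \<alpha>"
    by (simp add: norm_mult)
  moreover have "norm (\<i> * of_real y * v) = y * norm v"
    using y_pos by (simp add: norm_mult)
  ultimately show ?thesis
    unfolding \<Psi>_def using norm_triangle_ineq by metis
qed

lemma holomorphic_exp_Psi: "(\<lambda>v. exp (- \<Psi> v)) holomorphic_on {v. Im v < 0}"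
  unfolding \<Psi>_def
  by (intro holomorphic_intros) (auto simp: complex_nonpos_Reals_iff)

text \<open>With a primitive on the whole half-plane, contour integrals reduce to differences of its values at the endpoints.\<close>

lemma obtain_primitive:
  obtains \<Phi> where "\<And>v. Im v < 0 \<Longrightarrow> (\<Phi> has_field_derivative exp (- \<Psi> v)) (at v)"
proof -
  have op: "open {v. Im v < 0}" by (rule open_halfspace_Im_lt)
  obtain \<Phi> where "\<And>v. v \<in> {v. Im v < 0} \<Longrightarrow> (\<Phi> has_field_derivative exp (- \<Psi> v)) (at v within {v. Im v < 0})"
    using holomorphic_convex_primitive'[OF convex_halfspace_Im_lt op holomorphic_exp_Psi] by blast
  then have "(\<Phi> has_field_derivative exp (- \<Psi> v)) (at v)" if "Im v < 0" for v
    using at_within_open[OF _ op, of v] that by force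
  then show thesis by (rule that)
qed

text \<open>On the arc of radius \<open>r\<close> the derivative of the primitive is at most \<open>exp (- (\<kappa> r powr \<alpha>))\<close>, and the length of the arc
is at most \<open>\<pi> r\<close>. The bound tends to \<open>0\<close> both for \<open>r \<rightarrow> 0\<close> and for \<open>r \<rightarrow> \<infinity>\<close>.\<close>

lemma arc_estimate:
  assumes \<Phi>: "\<And>v. Im v < 0 \<Longrightarrow> (\<Phi> has_field_derivative exp (- \<Psi> v)) (at v)"
    and r: "0 < r" and a: "a \<in> sector"
  shows "norm (\<Phi> (rcis r a) - \<Phi> (rcis r (- (pi / 2)))) \<le> pi * (r * exp (- (\<kappa> * r powr \<alpha>)))"
proof -
  let ?B = "r * exp (- (\<kappa> * r powr \<alpha>))"
  have der: "((\<lambda>s. \<Phi> (rcis r s)) has_vector_derivative (\<i> * rcis r s) * exp (- \<Psi> (rcis r s))) (at s within sector)"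
    if s: "s \<in> sector" for s
  proof -
    have "sin s < 0" using s sin_gt_zero[of "- s"] by (simp add: sector_def)
    then have "Im (rcis r s) < 0" using r by (simp add: mult_pos_neg)
    then have "(\<Phi> has_field_derivative exp (- \<Psi> (rcis r s))) (at (rcis r s) within rcis r ` sector)"
      by (rule has_field_derivative_at_within[OF \<Phi>])
    moreover have "(rcis r has_vector_derivative \<i> * rcis r s) (at s within sector)"
    proof -
      have "((\<lambda>z. of_real r * exp (\<i> * z)) has_field_derivative \<i> * (of_real r * exp (\<i> * of_real s))) (at (of_real s))"
        by (auto intro!: derivative_eq_intros)
      from has_vector_derivative_real_field[OF this] show ?thesis
        by (simp add: rcis_def[abs_def] cis_conv_exp)
    qed
    ultimately show ?thesis
      using field_vector_diff_chain_within[of "rcis r" _ s sector \<Phi>] by (simp add: o_def)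
  qed
  have "norm (\<Phi> (rcis r a) - \<Phi> (rcis r (- (pi / 2)))) \<le> ?B * norm (a - (- (pi / 2)))"
  proof (rule differentiable_bound[OF convex_sector _ _ a minus_half_pi_in_sector])
    show "((\<lambda>s. \<Phi> (rcis r s)) has_derivative (\<lambda>h. h *\<^sub>R ((\<i> * rcis r s) * exp (- \<Psi> (rcis r s))))) (at s within sector)"
      if "s \<in> sector" for s
      using der[OF that] by (simp add: has_vector_derivative_def)
    show "onorm (\<lambda>h. h *\<^sub>R ((\<i> * rcis r s) * exp (- \<Psi> (rcis r s)))) \<le> ?B" if s: "s \<in> sector" for s
    proof (rule onorm_le)
      fix h :: real
      have "norm ((\<i> * rcis r s) * exp (- \<Psi> (rcis r s))) \<le> ?B"
        using Re_Psi_ge[OF r s] r by (simp add: norm_mult)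
      then show "norm (h *\<^sub>R ((\<i> * rcis r s) * exp (- \<Psi> (rcis r s)))) \<le> ?B * norm h"
        unfolding norm_scaleR by (simp add: mult.commute mult_left_mono)
    qed
  qed
  also have "\<dots> \<le> ?B * pi"
    using a r by (intro mult_left_mono) (auto simp: sector_def)
  finally show ?thesis by (simp add: mult.commute)
qed

end

section \<open>The scaled Cauchy transform of the free stable law\<close>

locale free_stable_curve = stable_exponent \<alpha> \<rho> y for \<alpha> \<rho> y :: real +
  fixes \<nu> :: "real measure"
  assumes free_stable: "free_stable \<alpha> \<rho> \<nu>"
begin

sublocale real_distribution \<nu>
  using free_stable by (simp add: free_stable_def)

text \<open>The outer factor is chosen so that both terms of \<open>\<Psi>\<close> become proportional to \<open>x\<close>; the inner one is what the
gamma variable \<open>x\<close> contributes to the product with \<open>X\<close>.\<close>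

definition curve :: "real \<Rightarrow> complex" where
  "curve x = of_real (x powr (1 / \<alpha>)) * cauchy_transform \<nu> (\<i> * of_real (y * x powr (1 / \<alpha> - 1)))"

lemma Im_curve_neg: "Im (curve x) < 0" if "0 < x"
  using Im_cauchy_transform_neg[of "\<i> * of_real (y * x powr (1 / \<alpha> - 1))"] that y_pos
  by (simp add: curve_def mult_pos_neg)

lemma norm_curve_le: "norm (curve x) \<le> x / y" if x: "0 < x"
proof -
  have "norm (curve x) \<le> x powr (1 / \<alpha>) * (1 / (y * x powr (1 / \<alpha> - 1)))"
  proof -
    have "norm (cauchy_transform \<nu> (\<i> * of_real (y * x powr (1 / \<alpha> - 1)))) \<le> 1 / (y * x powr (1 / \<alpha> - 1))"
      using norm_cauchy_transform_le[of "\<i> * of_real (y * x powr (1 / \<alpha> - 1))"] x y_pos by simp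
    then show ?thesis
      unfolding curve_def norm_mult norm_of_real by (intro mult_mono) auto
  qed
  also have "\<dots> = x / y"
    using x y_pos by (simp add: powr_diff field_simps)
  finally show ?thesis .
qed

text \<open>Multiplying the Voiculescu equation by \<open>w = G z\<close> gives a form without negative powers. The branches match because
\<open>w\<close> lies in the lower half-plane, where \<open>Ln (1 / w) = - Ln w\<close>.\<close>

lemma cauchy_transform_equation:
  assumes z: "0 < Im z"
  shows "z * cauchy_transform \<nu> z + exp (\<i> * of_real (pi * \<alpha> * \<rho>)) * cauchy_transform \<nu> z powr of_real \<alpha> = 1"
proof -
  define w where "w = cauchy_transform \<nu> z"
  have Imw: "Im w < 0" unfolding w_def by (rule Im_cauchy_transform_neg[OF z])
  then have w: "w \<noteq> 0" "w \<notin> \<real>\<^sub>\<le>\<^sub>0" by (auto simp: complex_nonpos_Reals_iff)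
  have "(1 / w) powr of_real (1 - \<alpha>) = exp (- Ln w + of_real \<alpha> * Ln w)"
    using w Ln_inverse[OF w(2)] by (simp add: powr_def inverse_eq_divide algebra_simps)
  also have "\<dots> = w powr of_real \<alpha> / w"
    using w by (simp add: exp_add exp_diff exp_minus powr_def field_simps)
  finally have pow: "(1 / w) powr of_real (1 - \<alpha>) = w powr of_real \<alpha> / w" .
  have "1 / w + free_stable_phi \<alpha> \<rho> (1 / w) = z"
    using free_stable z by (simp add: free_stable_def has_voiculescu_transform_def Let_def w_def)
  then have "1 / w - exp (\<i> * of_real (pi * \<alpha> * \<rho>)) * (w powr of_real \<alpha> / w) = z"
    unfolding free_stable_phi_def pow by simp
  then have "z * w = 1 - exp (\<i> * of_real (pi * \<alpha> * \<rho>)) * w powr of_real \<alpha>"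
    using w by (auto simp: field_simps)
  then show ?thesis by (simp add: w_def)
qed

text \<open>Both terms of \<open>\<Psi>\<close> scale by the same factor \<open>x\<close>: the factor \<open>x powr (1/\<alpha>)\<close> becomes \<open>x\<close> under the power \<open>\<alpha>\<close>, and
it equals \<open>x\<close> times the factor \<open>x powr (1/\<alpha> - 1)\<close> in the argument of the Cauchy transform.\<close>

lemma Psi_curve: "\<Psi> (curve x) = of_real x" if x: "0 < x"
proof -
  let ?z = "\<i> * of_real (y * x powr (1 / \<alpha> - 1))"
  let ?w = "cauchy_transform \<nu> ?z"
  have Imz: "0 < Im ?z" using x y_pos by simp
  have w: "?w \<noteq> 0" using Im_cauchy_transform_neg[OF Imz] by auto
  have "Ln (curve x) = of_real (ln (x powr (1 / \<alpha>))) + Ln ?w"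
    unfolding curve_def using x w by (subst Ln_times_of_real) (auto simp: Ln_of_real)
  also have "\<dots> = of_real (ln x / \<alpha>) + Ln ?w"
    using x by (simp add: ln_powr)
  finally have "curve x powr of_real \<alpha> = exp (of_real (ln x) + of_real \<alpha> * Ln ?w)"
    using alpha_pos w x by (simp add: powr_def curve_def distrib_left)
  also have "\<dots> = of_real x * ?w powr of_real \<alpha>"
    using x w by (simp add: exp_add exp_of_real powr_def)
  finally have pow: "curve x powr of_real \<alpha> = of_real x * ?w powr of_real \<alpha>" .
  have "x powr (1 / \<alpha>) = x * x powr (1 / \<alpha> - 1)"
    using x by (simp add: powr_diff)
  then have "\<i> * of_real y * curve x = of_real x * (?z * ?w)"
    by (simp add: curve_def)
  then have "\<Psi> (curve x) = of_real x * (?z * ?w + exp (\<i> * of_real (pi * \<alpha> * \<rho>)) * ?w powr of_real \<alpha>)"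
    unfolding \<Psi>_def pow by (simp add: algebra_simps)
  then show ?thesis
    unfolding cauchy_transform_equation[OF Imz] by simp
qed

lemma curve_differentiable: "\<exists>D. (curve has_vector_derivative D) (at x)" if x: "0 < x"
proof -
  let ?h = "\<lambda>x. y * x powr (1 / \<alpha> - 1)"
  have h: "(?h has_real_derivative y * ((1 / \<alpha> - 1) * x powr (1 / \<alpha> - 1 - 1))) (at x)"
    using x by (auto intro!: derivative_eq_intros)
  obtain D where D: "(cauchy_transform \<nu> has_field_derivative D) (at (\<i> * of_real (?h x)))"
    using has_field_derivative_cauchy_transform[of "\<i> * of_real (?h x)"] x y_pos by auto
  have "((\<lambda>z. cauchy_transform \<nu> (\<i> * z)) has_field_derivative D * \<i>) (at (of_real (?h x)))"
    by (rule DERIV_chain2[where f="cauchy_transform \<nu>" and g="\<lambda>z. \<i> * z" and x="of_real (?h x)", OF D])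
       (auto intro!: derivative_eq_intros)
  from has_vector_derivative_real_field[OF this]
  have "((\<lambda>t. cauchy_transform \<nu> (\<i> * of_real t)) has_vector_derivative D * \<i>) (at (?h x))" .
  from vector_diff_chain_at[OF h[unfolded has_real_derivative_iff_has_vector_derivative] this]
  obtain D' where D': "((\<lambda>x. cauchy_transform \<nu> (\<i> * of_real (?h x))) has_vector_derivative D') (at x)"
    by (auto simp: o_def)
  have "((\<lambda>x. x powr (1 / \<alpha>)) has_real_derivative (1 / \<alpha>) * x powr (1 / \<alpha> - 1)) (at x)"
    using x by (auto intro!: derivative_eq_intros)
  from has_vector_derivative_mult[OF has_vector_derivative_of_real[OF this] D']
  show ?thesis unfolding curve_def[abs_def] by blast
qed

lemma continuous_on_curve: "continuous_on {0<..} curve"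
proof (rule continuous_at_imp_continuous_on, rule ballI)
  fix x :: real assume "x \<in> {0<..}"
  then obtain D where "(curve has_vector_derivative D) (at x)"
    using curve_differentiable by auto
  then show "isCont curve x" by (rule has_vector_derivative_continuous)
qed

lemma Arg_curve_in_sector: "Arg (curve x) \<in> sector" if x: "0 < x"
proof (rule in_sector_if_Im_Psi_0)
  show "0 < norm (curve x)" using Im_curve_neg[OF x] by auto
  show "- pi < Arg (curve x)" by (rule mpi_less_Arg)
  show "Arg (curve x) < 0" using Im_curve_neg[OF x] by (simp add: Arg_neg_iff)
  show "Im (\<Psi> (rcis (norm (curve x)) (Arg (curve x)))) = 0"
    by (simp add: rcis_cmod_Arg Psi_curve[OF x])
qed

text \<open>Where the curve is bounded, so is \<open>x = \<Psi> (v x)\<close>; hence the curve is unbounded as \<open>x \<rightarrow> \<infinity>\<close>, without returning.\<close>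

lemma norm_curve_at_top: "filterlim (\<lambda>n. norm (curve (u n))) at_top sequentially"
  if u: "filterlim u at_top sequentially"
  unfolding filterlim_at_top
proof
  fix R :: real
  have "eventually (\<lambda>n. max 1 (y * \<bar>R\<bar> + \<bar>R\<bar> powr \<alpha> + 1) \<le> u n) sequentially"
    using u unfolding filterlim_at_top by blast
  then show "eventually (\<lambda>n. R \<le> norm (curve (u n))) sequentially"
  proof eventually_elim
    case (elim n)
    then have un: "0 < u n" by linarith
    show ?case
    proof (rule ccontr)
      assume "\<not> R \<le> norm (curve (u n))"
      then have le: "norm (curve (u n)) \<le> \<bar>R\<bar>" by linarith
      have "u n \<le> y * norm (curve (u n)) + norm (curve (u n)) powr \<alpha>"
        using norm_Psi_le[of "curve (u n)"] un by (simp add: Psi_curve)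
      also have "\<dots> \<le> y * \<bar>R\<bar> + \<bar>R\<bar> powr \<alpha>"
        using le y_pos alpha_pos by (intro add_mono mult_left_mono powr_mono2) auto
      finally show False using elim by linarith
    qed
  qed
qed

lemma exp_curve_integrable: "set_integrable lborel {0<..} (\<lambda>x. of_real (exp (- x)) * curve x)"
proof (rule set_integrable_complex_bound)
  show "continuous_on {0<..} (\<lambda>x. of_real (exp (- x)) * curve x)"
    using continuous_on_curve by (intro continuous_intros) auto
  show "set_integrable lborel {0<..} (\<lambda>x. exp (- (x * (1/2))) * (2 / y))"
    by (intro set_integrable_mult_left integrable_I0i_exp_mscale) simp
  fix x :: real assume x: "0 < x"
  \<comment> \<open>half of the exponential decay absorbs the linear growth of the curve\<close>
  have "x \<le> 2 * exp (x / 2)" using exp_ge_add_one_self[of "x / 2"] by linarith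
  then have "exp (- x) * x \<le> exp (- x) * (2 * exp (x / 2))" by (intro mult_left_mono) auto
  also have "\<dots> = 2 * exp (- (x / 2))" by (simp add: mult_exp_exp)
  finally have "exp (- x) * x / y \<le> 2 * exp (- (x / 2)) / y"
    using y_pos by (intro divide_right_mono) auto
  moreover have "norm (of_real (exp (- x)) * curve x) \<le> exp (- x) * (x / y)"
    using norm_curve_le[OF x] unfolding norm_mult by (intro mult_mono) auto
  ultimately show "norm (of_real (exp (- x)) * curve x) \<le> exp (- (x * (1/2))) * (2 / y)"
    by (simp add: mult.commute)
qed

lemma continuous_on_exp_Psi_axis: "continuous_on {0<..} (\<lambda>s. exp (- \<Psi> (rcis s (- (pi / 2)))))"
proof (rule continuous_on_compose2[of "{v. Im v < 0}" "\<lambda>v. exp (- \<Psi> v)"])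
  show "continuous_on {v. Im v < 0} (\<lambda>v. exp (- \<Psi> v))"
    by (rule holomorphic_on_imp_continuous_on[OF holomorphic_exp_Psi])
qed (auto simp: rcis_def intro!: continuous_intros)

lemma exp_Psi_axis_integrable:
  "set_integrable lborel {0<..} (\<lambda>s. - \<i> * exp (- \<Psi> (rcis s (- (pi / 2)))))"
proof (rule set_integrable_complex_bound)
  show "continuous_on {0<..} (\<lambda>s. - \<i> * exp (- \<Psi> (rcis s (- (pi / 2)))))"
    by (intro continuous_on_mult continuous_on_const continuous_on_exp_Psi_axis)
  show "set_integrable lborel {0<..} (\<lambda>s. exp (- (s * y)))"
    by (rule integrable_I0i_exp_mscale[OF y_pos])
  fix s :: real assume s: "0 < s"
  have "\<bar>\<alpha> * (pi * \<rho> + - (pi / 2))\<bar> = pi * (\<alpha> * \<bar>\<rho> - 1/2\<bar>)"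
  proof -
    have "\<alpha> * (pi * \<rho> + - (pi / 2)) = pi * (\<alpha> * (\<rho> - 1/2))" by (simp add: algebra_simps)
    then show ?thesis using alpha_pos by (simp add: abs_mult)
  qed
  then have "\<kappa> = cos (\<alpha> * (pi * \<rho> + - (pi / 2)))"
    unfolding \<kappa>_def by (metis cos_abs_real)
  then have "0 \<le> s powr \<alpha> * cos (\<alpha> * (pi * \<rho> + - (pi / 2)))" using kappa_pos by simp
  then have "s * y \<le> Re (\<Psi> (rcis s (- (pi / 2))))"
    using s order_trans[OF _ pi_ge_zero, of "- (pi / 2)"]
    by (subst Psi_rcis) (auto simp: mult.commute)
  then show "norm (- \<i> * exp (- \<Psi> (rcis s (- (pi / 2))))) \<le> exp (- (s * y))"
    by (simp add: norm_mult)
qed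

text \<open>Let \<open>\<Phi>\<close> be a primitive of \<open>exp (- \<Psi>)\<close>. Then \<open>\<Phi> (v x) - exp (- x) v x\<close> is a primitive of \<open>exp (- x) v x\<close>, because
\<open>exp (- \<Psi> (v x)) = exp (- x)\<close>, and \<open>\<Phi> (- \<i> s)\<close> is a primitive of the integrand on the right. At corresponding endpoints \<open>x\<close>
and \<open>s = \<bar>v x\<bar>\<close> the two primitives differ by an amount that vanishes in both limits.\<close>

lemma laplace_curve_eq:
  "(LINT x:{0<..}|lborel. of_real (exp (- x)) * curve x)
     = (LINT s:{0<..}|lborel. - \<i> * exp (- \<Psi> (rcis s (- (pi / 2)))))"
proof -
  obtain \<Phi> where \<Phi>: "\<And>v. Im v < 0 \<Longrightarrow> (\<Phi> has_field_derivative exp (- \<Psi> v)) (at v)"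
    by (rule obtain_primitive) blast
  define u l where "u n = real (Suc n)" and "l n = 1 / real (Suc n)" for n
  have u: "filterlim u at_top sequentially"
    unfolding u_def by (rule filterlim_compose[OF filterlim_real_sequentially filterlim_Suc])
  have l: "l \<longlonglongrightarrow> 0"
    unfolding l_def by (rule LIMSEQ_Suc[OF lim_1_over_n])
  have pos: "0 < u n" "0 < l n" for n by (auto simp: u_def l_def)
  let ?r = "\<lambda>x. norm (curve x)"
  have rpos: "0 < ?r x" if "0 < x" for x using Im_curve_neg[OF that] by auto
  define F where "F x = \<Phi> (curve x) - of_real (exp (- x)) * curve x" for x
  define G where "G s = \<Phi> (rcis s (- (pi / 2)))" for s
  have F: "(F has_vector_derivative of_real (exp (- x)) * curve x) (at x)" if x: "0 < x" for x
  proof -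
    obtain D where D: "(curve has_vector_derivative D) (at x)"
      using curve_differentiable[OF x] by blast
    have 1: "((\<lambda>x. \<Phi> (curve x)) has_vector_derivative D * exp (- \<Psi> (curve x))) (at x)"
      using field_vector_diff_chain_at[OF D \<Phi>[OF Im_curve_neg[OF x]]] by (simp add: o_def)
    have "((\<lambda>x. exp (- x)) has_real_derivative - exp (- x)) (at x)"
      by (auto intro!: derivative_eq_intros)
    from has_vector_derivative_mult[OF has_vector_derivative_of_real[OF this] D]
    have 2: "((\<lambda>x. of_real (exp (- x)) * curve x) has_vector_derivative
        of_real (exp (- x)) * D + of_real (- exp (- x)) * curve x) (at x)" .
    have "exp (- \<Psi> (curve x)) = of_real (exp (- x))"
      using Psi_curve[OF x] by (simp add: exp_of_real[symmetric] del: exp_of_real)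
    with has_vector_derivative_diff[OF 1 2] show ?thesis
      unfolding F_def[abs_def] by (simp add: mult.commute)
  qed
  have G: "(G has_vector_derivative - \<i> * exp (- \<Psi> (rcis s (- (pi / 2))))) (at s)" if s: "0 < s" for s
  proof -
    have eq: "rcis s (- (pi / 2)) = of_real s * - \<i>" for s
      by (simp add: rcis_def cis.ctr complex_eq_iff)
    have "Im (of_real s * - \<i>) < 0" using s by simp
    from \<Phi>[OF this]
    have "((\<lambda>z. \<Phi> (z * - \<i>)) has_field_derivative exp (- \<Psi> (of_real s * - \<i>)) * - \<i>) (at (of_real s))"
      by (rule DERIV_chain2[where f=\<Phi> and g="\<lambda>z. z * - \<i>" and x="of_real s"])
         (auto intro!: derivative_eq_intros)
    from has_vector_derivative_real_field[OF this] show ?thesis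
      unfolding G_def[abs_def] eq by (simp add: mult.commute)
  qed
  have 1: "(\<lambda>n. F (u n) - F (l n)) \<longlonglongrightarrow> (LINT x:{0<..}|lborel. of_real (exp (- x)) * curve x)"
  proof (rule half_line_FTC[OF exp_curve_integrable _ F pos(2) l u])
    show "continuous_on {0<..} (\<lambda>x. of_real (exp (- x)) * curve x)"
      using continuous_on_curve by (intro continuous_intros) auto
  qed
  have r0: "(\<lambda>n. ?r (l n)) \<longlonglongrightarrow> 0"
  proof (rule tendsto_sandwich[OF always_eventually always_eventually tendsto_const])
    show "(\<lambda>n. l n / y) \<longlonglongrightarrow> 0" using tendsto_divide[OF l tendsto_const, of y] y_pos by simp
  qed (use norm_curve_le pos in auto)
  have rinf: "filterlim (\<lambda>n. ?r (u n)) at_top sequentially"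
    by (rule norm_curve_at_top[OF u])
  have 2: "(\<lambda>n. G (?r (u n)) - G (?r (l n))) \<longlonglongrightarrow> (LINT s:{0<..}|lborel. - \<i> * exp (- \<Psi> (rcis s (- (pi / 2)))))"
  proof (rule half_line_FTC[OF exp_Psi_axis_integrable _ G _ r0 rinf])
    show "continuous_on {0<..} (\<lambda>s. - \<i> * exp (- \<Psi> (rcis s (- (pi / 2)))))"
      by (intro continuous_on_mult continuous_on_const continuous_on_exp_Psi_axis)
  qed (use rpos pos in auto)
  let ?arc = "\<lambda>r. pi * (r * exp (- (\<kappa> * r powr \<alpha>)))"
  have bound: "norm (F x - G (?r x)) \<le> ?arc (?r x) + exp (- x) * (x / y)" if x: "0 < x" for x
  proof -
    have "F x - G (?r x) = (\<Phi> (rcis (?r x) (Arg (curve x))) - \<Phi> (rcis (?r x) (- (pi / 2)))) - of_real (exp (- x)) * curve x"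
      by (simp add: F_def G_def rcis_cmod_Arg)
    also have "norm \<dots> \<le> norm (\<Phi> (rcis (?r x) (Arg (curve x))) - \<Phi> (rcis (?r x) (- (pi / 2)))) + norm (of_real (exp (- x)) * curve x)"
      by (rule norm_triangle_ineq4)
    also have "\<dots> \<le> ?arc (?r x) + exp (- x) * (x / y)"
      using norm_curve_le[OF x] unfolding norm_mult
      by (intro add_mono mult_mono arc_estimate[OF \<Phi> rpos[OF x] Arg_curve_in_sector[OF x]]) auto
    finally show ?thesis .
  qed
  have up: "(\<lambda>n. F (u n) - G (?r (u n))) \<longlonglongrightarrow> 0"
  proof (rule Lim_null_comparison)
    show "eventually (\<lambda>n. norm (F (u n) - G (?r (u n))) \<le> ?arc (?r (u n)) + exp (- u n) * (u n / y)) sequentially"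
      using bound pos by (intro always_eventually) auto
    have "(?arc \<longlongrightarrow> 0) at_top" using kappa_pos alpha_pos by real_asymp
    moreover have "((\<lambda>x. exp (- x) * (x / y)) \<longlongrightarrow> 0) at_top" using y_pos by real_asymp
    ultimately have "(\<lambda>n. ?arc (?r (u n)) + exp (- u n) * (u n / y)) \<longlonglongrightarrow> 0 + 0"
      using rinf u by (intro tendsto_add) (rule filterlim_compose, assumption, assumption)+
    then show "(\<lambda>n. ?arc (?r (u n)) + exp (- u n) * (u n / y)) \<longlonglongrightarrow> 0" by simp
  qed
  have low: "(\<lambda>n. F (l n) - G (?r (l n))) \<longlonglongrightarrow> 0"
  proof (rule Lim_null_comparison)
    have "?arc (?r (l n)) \<le> pi * (?r (l n) * 1)" for n
      using kappa_pos by (intro mult_left_mono) auto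
    moreover have "exp (- l n) * (l n / y) \<le> 1 * (l n / y)" for n
      using pos(2)[of n] y_pos by (intro mult_right_mono) auto
    ultimately show "eventually (\<lambda>n. norm (F (l n) - G (?r (l n))) \<le> pi * (?r (l n) * 1) + 1 * (l n / y)) sequentially"
      using bound[OF pos(2)] by (intro always_eventually allI) (meson add_mono order_trans)
    have "(\<lambda>n. pi * (?r (l n) * 1) + 1 * (l n / y)) \<longlonglongrightarrow> pi * (0 * 1) + 1 * (0 / y)"
      using y_pos by (intro tendsto_intros r0 l) auto
    then show "(\<lambda>n. pi * (?r (l n) * 1) + 1 * (l n / y)) \<longlonglongrightarrow> 0" by simp
  qed
  have "(\<lambda>n. (F (u n) - F (l n)) - (G (?r (u n)) - G (?r (l n)))) \<longlonglongrightarrow> 0"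
    using tendsto_diff[OF up low] by (simp add: algebra_simps)
  moreover have "(\<lambda>n. (F (u n) - F (l n)) - (G (?r (u n)) - G (?r (l n)))) \<longlonglongrightarrow>
      (LINT x:{0<..}|lborel. of_real (exp (- x)) * curve x) - (LINT s:{0<..}|lborel. - \<i> * exp (- \<Psi> (rcis s (- (pi / 2)))))"
    by (rule tendsto_diff[OF 1 2])
  ultimately show ?thesis
    using LIMSEQ_unique by fastforce
qed

end

section \<open>Comparison of the two laws\<close>

text \<open>For fixed \<open>t\<close>, the Cauchy transform of \<open>t powr (1 - 1/\<alpha>) X\<close> at \<open>\<i> y\<close> is \<open>q G (\<i> y q)\<close> with
\<open>q = t powr (1/\<alpha> - 1)\<close>, and the factor \<open>t\<close> of the gamma density completes \<open>q\<close> to \<open>t powr (1/\<alpha>)\<close>.\<close>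

lemma (in free_stable_curve) cauchy_transform_gamma_product:
  "(\<integral>t. (\<integral>x. 1 / (\<i> * of_real y - of_real (x * t powr (1 - 1 / \<alpha>))) \<partial>\<nu>)
      \<partial>density lborel (\<lambda>x. ennreal (if x > 0 then x * exp (- x) else 0)))
   = (LINT x:{0<..}|lborel. of_real (exp (- x)) * curve x)"
proof -
  let ?k = "\<lambda>t. \<integral>x. 1 / (\<i> * of_real y - of_real (x * t powr (1 - 1 / \<alpha>))) \<partial>\<nu>"
  have "(\<integral>t. ?k t \<partial>density lborel (\<lambda>x. ennreal (if x > 0 then x * exp (- x) else 0)))
      = (\<integral>t. (if t > 0 then t * exp (- t) else 0) *\<^sub>R ?k t \<partial>lborel)"
    by (rule integral_density) (auto intro!: borel_measurable_lebesgue_integral)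
  also have "\<dots> = (LINT t:{0<..}|lborel. of_real (exp (- t)) * curve t)"
    unfolding set_lebesgue_integral_def
  proof (rule Bochner_Integration.integral_cong[OF refl])
    fix t :: real
    show "(if t > 0 then t * exp (- t) else 0) *\<^sub>R ?k t
        = indicator {0<..} t *\<^sub>R (of_real (exp (- t)) * curve t)"
    proof (cases "0 < t")
      case True
      define q where "q = t powr (1 / \<alpha> - 1)"
      have q: "0 < q" using True by (simp add: q_def)
      have "t powr (1 - 1 / \<alpha>) * q = 1"
        using True by (simp add: q_def powr_add[symmetric])
      then have pq: "t powr (1 - 1 / \<alpha>) = 1 / q" using q by (simp add: field_simps)
      have tq: "t * q = t powr (1 / \<alpha>)"
        using True by (simp add: q_def powr_diff)
      have "1 / (\<i> * of_real y - of_real (x * t powr (1 - 1 / \<alpha>)))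
          = of_real q * (1 / (\<i> * of_real (y * q) - complex_of_real x))" for x
      proof -
        have ne: "\<i> * of_real (y * q) - complex_of_real x \<noteq> 0"
          using y_pos q by (auto simp: complex_eq_iff)
        have "\<i> * of_real y - of_real (x * t powr (1 - 1 / \<alpha>)) = (\<i> * of_real (y * q) - complex_of_real x) / of_real q"
          using q by (simp add: pq field_simps)
        then show ?thesis using q by simp
      qed
      then have "?k t = of_real q * cauchy_transform \<nu> (\<i> * of_real (y * q))"
        by (simp only: cauchy_transform_def integral_mult_right_zero)
      then have "(t * exp (- t)) *\<^sub>R ?k t = of_real (exp (- t)) * (of_real (t * q) * cauchy_transform \<nu> (\<i> * of_real (y * q)))"
        by (simp add: scaleR_conv_of_real algebra_simps)
      also have "\<dots> = of_real (exp (- t)) * curve t"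
        by (simp only: curve_def tq q_def[symmetric])
      finally show ?thesis using True by simp
    qed simp
  qed
  finally show ?thesis .
qed

lemma (in stable_exponent) cauchy_transform_classical_stable:
  assumes "classical_stable \<alpha> \<rho> \<mu>"
  shows "cauchy_transform \<mu> (\<i> * of_real y) = (LINT s:{0<..}|lborel. - \<i> * exp (- \<Psi> (rcis s (- (pi / 2)))))"
proof -
  interpret real_distribution \<mu> using assms by (simp add: classical_stable_def)
  have "cauchy_transform \<mu> (\<i> * of_real y) = - \<i> * (LINT s:{0<..}|lborel. of_real (exp (- (y * s))) * char \<mu> (- s))"
    by (rule cauchy_transform_eq_laplace_char[OF y_pos])
  also have "\<dots> = (LINT s:{0<..}|lborel. - \<i> * (of_real (exp (- (y * s))) * char \<mu> (- s)))"
    by (rule set_integral_mult_right[symmetric])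
  also have "\<dots> = (LINT s:{0<..}|lborel. - \<i> * exp (- \<Psi> (rcis s (- (pi / 2)))))"
  proof (rule set_lebesgue_integral_cong)
    show "\<forall>s. s \<in> {0<..} \<longrightarrow> - \<i> * (of_real (exp (- (y * s))) * char \<mu> (- s)) = - \<i> * exp (- \<Psi> (rcis s (- (pi / 2))))"
    proof (intro allI impI)
      fix s :: real assume "s \<in> {0<..}"
      then have s: "0 < s" by simp
      define \<theta> where "\<theta> = pi * \<alpha> * (1/2 - \<rho>)"
      have "char \<mu> (- s) = cnj (exp (- (of_real (s powr \<alpha>) * exp (\<i> * of_real \<theta>))))"
        using assms s by (simp add: char_minus classical_stable_def \<theta>_def)
      also have "\<dots> = exp (- (of_real (s powr \<alpha>) * cis (- \<theta>)))"
        by (simp add: exp_cnj cis_cnj cis_conv_exp)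
      finally have ch: "char \<mu> (- s) = exp (- (of_real (s powr \<alpha>) * cis (- \<theta>)))" .
      have "\<alpha> * (pi * \<rho> + - (pi / 2)) = - \<theta>" by (simp add: \<theta>_def algebra_simps)
      then have "\<Psi> (rcis s (- (pi / 2))) = of_real (y * s) + of_real (s powr \<alpha>) * cis (- \<theta>)"
        using s pi_gt_zero order_trans[OF _ pi_ge_zero, of "- (pi / 2)"]
        by (auto simp: complex_eq_iff Psi_rcis)
      then have "exp (- \<Psi> (rcis s (- (pi / 2)))) = of_real (exp (- (y * s))) * char \<mu> (- s)"
        unfolding ch by (simp add: exp_add[symmetric] exp_of_real[symmetric] del: exp_of_real)
      then show "- \<i> * (of_real (exp (- (y * s))) * char \<mu> (- s)) = - \<i> * exp (- \<Psi> (rcis s (- (pi / 2))))"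
        by simp
    qed
  qed simp
  finally show ?thesis .
qed

theorem corollary3:
  fixes \<alpha> \<rho> :: real
    and M :: "'a measure" and X Z :: "'a \<Rightarrow> real"
    and N :: "'b measure" and Y :: "'b \<Rightarrow> real"
  assumes "(\<alpha>, \<rho>) \<in> admissible_params"
    and "prob_space M" and "prob_space N"
    and "X \<in> borel_measurable M" and "free_stable \<alpha> \<rho> (distr M borel X)"
    and "Y \<in> borel_measurable N" and "classical_stable \<alpha> \<rho> (distr N borel Y)"
    and "distributed M lborel Z (\<lambda>x. ennreal (if x > 0 then x * exp (- x) else 0))"
    and "prob_space.indep_var M borel X borel Z"
  shows "distr N borel Y = distr M borel (\<lambda>\<omega>. X \<omega> * Z \<omega> powr (1 - 1 / \<alpha>))"
proof (rule real_distribution_eq_if_cauchy_transform_eq)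
  interpret M: prob_space M by fact
  interpret N: prob_space N by fact
  note [measurable] = assms(4,6)
  have Zm[measurable]: "Z \<in> borel_measurable M"
    using distributed_measurable[OF assms(8)] by simp
  let ?W = "\<lambda>\<omega>. X \<omega> * Z \<omega> powr (1 - 1 / \<alpha>)"
  show "real_distribution (distr N borel Y)" by (rule N.real_distribution_distr) fact
  show "real_distribution (distr M borel ?W)" by (rule M.real_distribution_distr) measurable
  let ?\<nu> = "distr M borel X" and ?\<gamma> = "density lborel (\<lambda>x. ennreal (if x > 0 then x * exp (- x) else 0))"
  have Z: "distr M borel Z = ?\<gamma>"
    using distributed_distr_eq_density[OF assms(8)] distr_cong[of M M lborel borel Z Z] by simp
  interpret X: prob_space ?\<nu> by (rule M.prob_space_distr) measurable
  interpret Z: prob_space ?\<gamma> unfolding Z[symmetric] by (rule M.prob_space_distr) measurable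
  interpret XZ: pair_prob_space ?\<nu> ?\<gamma> ..
  have joint: "?\<nu> \<Otimes>\<^sub>M ?\<gamma> = distr M (borel \<Otimes>\<^sub>M borel) (\<lambda>\<omega>. (X \<omega>, Z \<omega>))"
    using assms(9) unfolding M.indep_var_distribution_eq Z by simp
  fix y :: real assume y: "0 < y"
  interpret free_stable_curve \<alpha> \<rho> y ?\<nu>
    by unfold_locales (use assms y in auto)
  let ?k = "\<lambda>(x, t). 1 / (\<i> * of_real y - complex_of_real (x * t powr (1 - 1 / \<alpha>)))"
  have int: "integrable (?\<nu> \<Otimes>\<^sub>M ?\<gamma>) ?k"
  proof (rule XZ.integrable_const_bound[where B="1 / y"])
    have "norm (?k p) \<le> 1 / y" for p
      using norm_cauchy_kernel_le[of "\<i> * of_real y" "fst p * snd p powr (1 - 1 / \<alpha>)"] y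
      by (simp add: split_beta)
    then show "AE p in ?\<nu> \<Otimes>\<^sub>M ?\<gamma>. norm (?k p) \<le> 1 / y" by simp
  qed measurable
  have "cauchy_transform (distr M borel ?W) (\<i> * of_real y) = (\<integral>\<omega>. ?k (X \<omega>, Z \<omega>) \<partial>M)"
    unfolding cauchy_transform_def by (subst integral_distr) simp_all
  also have "\<dots> = (\<integral>p. ?k p \<partial>(?\<nu> \<Otimes>\<^sub>M ?\<gamma>))"
    unfolding joint by (rule integral_distr[symmetric]) measurable
  also have "\<dots> = (\<integral>t. (\<integral>x. 1 / (\<i> * of_real y - of_real (x * t powr (1 - 1 / \<alpha>))) \<partial>?\<nu>) \<partial>?\<gamma>)"
    using XZ.integral_snd[OF int] by simp
  also have "\<dots> = (LINT x:{0<..}|lborel. of_real (exp (- x)) * curve x)"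
    by (rule cauchy_transform_gamma_product)
  also have "\<dots> = cauchy_transform (distr N borel Y) (\<i> * of_real y)"
    unfolding laplace_curve_eq by (rule cauchy_transform_classical_stable[OF assms(7), symmetric])
  finally show "cauchy_transform (distr N borel Y) (\<i> * of_real y) = cauchy_transform (distr M borel ?W) (\<i> * of_real y)"
    by (rule sym)
qed

end
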